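(* The pattern class $\operatorname{Av}(4321,2143)$ is equal to the union $\mathcal{A}\cup\mathcal{B}\cup\mathcal{C}\cup\mathcal{D}$ of the following four monotone grid classes, where each class is specified by its numbers of columns and rows and its list of increasing cells (every other cell is empty), cells written as (column, row): $\mathcal{A}$: 3 columns, 3 rows, increasing cells $(1,1),(2,3),(3,2),(3,3)$; $\mathcal{B}$: 3 columns, 3 rows, increasing cells $(1,1),(1,2),(2,1),(3,3)$; $\mathcal{C}$: 8 columns, 4 rows, increasing cells $(1,1),(2,3),(3,4),(4,2),(5,3),(6,1),(7,2),(8,4)$; $\mathcal{D}$: 4 columns, 8 rows, increasing cells $(1,1),(3,2),(4,3),(2,4),(3,5),(1,6),(2,7),(4,8)$.
   Context: A permutation $\pi$ contains $\sigma$ (as a pattern) if $\pi$ has a subsequence whose entries are ordered relatively the same as the entries of $\sigma$; $\operatorname{Av}(B)$ denotes the set of permutations containing no element of $B$. Monotone grid classes: given a diagram of $k$ columns and $l$ rows of cells, columns numbered $1,\dots,k$ from left to right and rows $1,\dots,l$ from bottom to top, each cell being empty, increasing or decreasing, a permutation $\pi$ of length $n$ belongs to the associated class if there exist integers $0=c_0\le c_1\le\dots\le c_k=n$ and $0=r_0\le\dots\le r_l=n$ such that for every cell $(i,j)$ the set of points $(p,\pi(p))$ with $c_{i-1}<p\le c_i$ and $r_{j-1}<\pi(p)\le r_j$ is empty if the cell is empty, and forms an increasing (resp. decreasing) sequence, possibly empty, if the cell is increasing (resp. decreasing). *)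

theory Defs
  imports "HOL-Library.Sublist" "HOL-Combinatorics.Multiset_Permutations"
begin

(* Permutations of {1,...,n} in one-line notation, for all n >= 0 at once. *)
definition perms :: "nat list set" where
  "perms = (\<Union>n. permutations_of_set {1..n})"

definition order_isomorphic :: "nat list \<Rightarrow> nat list \<Rightarrow> bool" where
  "order_isomorphic xs ys \<longleftrightarrow> length xs = length ys \<and>
     (\<forall>i < length xs. \<forall>j < length xs. xs ! i < xs ! j \<longleftrightarrow> ys ! i < ys ! j)"

(* subseq is the library's not necessarily contiguous subsequence relation. *)
definition contains_pattern :: "nat list \<Rightarrow> nat list \<Rightarrow> bool" where
  "contains_pattern \<pi> \<sigma> \<longleftrightarrow> (\<exists>xs. subseq xs \<pi> \<and> order_isomorphic xs \<sigma>)"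

definition Av :: "nat list set \<Rightarrow> nat list set" where
  "Av B = {\<pi> \<in> perms. \<forall>\<sigma> \<in> B. \<not> contains_pattern \<pi> \<sigma>}"

datatype cell = Empty | Increasing | Decreasing

(* List indices start at 0, whereas positions in a permutation start at 1. *)
definition entry :: "nat list \<Rightarrow> nat \<Rightarrow> nat" where
  "entry \<pi> p = \<pi> ! (p - 1)"

(* A set of points (p, \<pi>(p)) is represented by its set P of positions. *)
definition fits_cell :: "cell \<Rightarrow> nat list \<Rightarrow> nat set \<Rightarrow> bool" where
  "fits_cell t \<pi> P = (case t of
      Empty \<Rightarrow> P = {}
    | Increasing \<Rightarrow> strict_mono_on P (entry \<pi>)
    | Decreasing \<Rightarrow> strict_antimono_on P (entry \<pi>))"

(* k columns and l rows; M (i, j) is the cell in column i and row j, and only its values for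
   i in {1..k} and j in {1..l} matter. *)
definition grid_class :: "nat \<Rightarrow> nat \<Rightarrow> (nat \<times> nat \<Rightarrow> cell) \<Rightarrow> nat list set" where
  "grid_class k l M = {\<pi> \<in> perms. \<exists>c r :: nat \<Rightarrow> nat.
     c 0 = 0 \<and> c k = length \<pi> \<and> mono_on {0..k} c \<and>
     r 0 = 0 \<and> r l = length \<pi> \<and> mono_on {0..l} r \<and>
     (\<forall>i \<in> {1..k}. \<forall>j \<in> {1..l}.
        fits_cell (M (i, j)) \<pi>
          {p. c (i - 1) < p \<and> p \<le> c i \<and> r (j - 1) < entry \<pi> p \<and> entry \<pi> p \<le> r j})}"

definition increasing_cells :: "(nat \<times> nat) set \<Rightarrow> nat \<times> nat \<Rightarrow> cell" where
  "increasing_cells S ij = (if ij \<in> S then Increasing else Empty)"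

definition class_A :: "nat list set" where
  "class_A = grid_class 3 3 (increasing_cells {(1,1), (2,3), (3,2), (3,3)})"

definition class_B :: "nat list set" where
  "class_B = grid_class 3 3 (increasing_cells {(1,1), (1,2), (2,1), (3,3)})"

definition class_C :: "nat list set" where
  "class_C = grid_class 8 4 (increasing_cells
     {(1,1), (2,3), (3,4), (4,2), (5,3), (6,1), (7,2), (8,4)})"

definition class_D :: "nat list set" where
  "class_D = grid_class 4 8 (increasing_cells
     {(1,1), (3,2), (4,3), (2,4), (3,5), (1,6), (2,7), (4,8)})"

end

theory Submission
  imports Defs
begin

text \<open>
  A monotone grid class avoids both patterns as soon as no four of its cells can carry one of them,
  which is a finite check. For the converse, let \<open>f\<close> be a permutation avoiding both patterns.
  If \<open>f\<close> has at most two descents, cut it into three increasing runs \<open>X\<close>, \<open>Y\<close>, \<open>Z\<close> and the values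
  into those below, within and above the interval \<open>[min Y, max Y]\<close>; inside that interval all of \<open>Z\<close>
  lies below all of \<open>X\<close>, since otherwise \<open>min Y\<close> and \<open>max Y\<close> complete an occurrence of 2143. This is
  exactly a gridding of class C, and the inverse permutations give class D. Finally, class A arises
  by cutting positions after the first run of \<open>f\<close> and values after the first run of its inverse: the
  only obstruction is an inversion above and to the right of both cuts. Dually for class B with the
  last runs. If \<open>f\<close> and its inverse both have three descents, the two obstructions cannot coexist.
\<close>

section \<open>Avoidance and griddings for functions on the naturals\<close>

text \<open>The first conjunct excludes 4321, the second 2143. Positions carry no bound because a
  map permuting \<open>{1..n}\<close> has all its inversions inside \<open>{1..n}\<close>.\<close>

definition avoids :: "(nat \<Rightarrow> nat) \<Rightarrow> bool" where
  "avoids f \<longleftrightarrow> (\<forall>i j k l. i < j \<and> j < k \<and> k < l \<longrightarrow>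
     \<not> (f l < f k \<and> f k < f j \<and> f j < f i) \<and> \<not> (f j < f i \<and> f i < f l \<and> f l < f k))"

text \<open>Cuts of a grid class are encoded by the monotone maps sending a position to its column and
  a value to its row.\<close>

definition gridded :: "(nat \<times> nat) set \<Rightarrow> nat \<Rightarrow> (nat \<Rightarrow> nat) \<Rightarrow> bool" where
  "gridded S n f \<longleftrightarrow> (\<exists>col row. mono_on {1..n} col \<and> mono_on {1..n} row \<and>
     (\<forall>p \<in> {1..n}. (col p, row (f p)) \<in> S) \<and>
     (\<forall>p \<in> {1..n}. \<forall>q \<in> {1..n}.
        p < q \<and> col p = col q \<and> row (f p) = row (f q) \<longrightarrow> f p < f q))"

text \<open>Outside the positions of \<open>\<pi>\<close> this is the identity, which creates no inversions and hence
  no occurrences of 4321 or 2143.\<close>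

definition perm_fun :: "nat list \<Rightarrow> nat \<Rightarrow> nat" where
  "perm_fun \<pi> p = (if p \<in> {1..length \<pi>} then entry \<pi> p else p)"

section \<open>From one-line notation to permutations of \<open>{1..n}\<close>\<close>

lemma perms_iff: "\<pi> \<in> perms \<longleftrightarrow> set \<pi> = {1..length \<pi>} \<and> distinct \<pi>"
proof -
  have "n = length \<pi>" if "set \<pi> = {1..n}" "distinct \<pi>" for n
    using distinct_card[OF that(2)] that(1) by simp
  then show ?thesis
    unfolding perms_def permutations_of_set_def by blast
qed

lemma perm_fun_permutes:
  assumes "\<pi> \<in> perms"
  shows "perm_fun \<pi> permutes {1..length \<pi>}"
proof -
  have s: "set \<pi> = {1..length \<pi>}" and d: "distinct \<pi>"
    using assms unfolding perms_iff by blast+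
  have "bij_betw (\<lambda>p. \<pi> ! (p - 1)) {1..length \<pi>} {1..length \<pi>}"
  proof (rule bij_betw_imageI)
    show "inj_on (\<lambda>p. \<pi> ! (p - 1)) {1..length \<pi>}"
      using d by (auto simp: inj_on_def nth_eq_iff_index_eq)
    have "{1..length \<pi>} = Suc ` {..<length \<pi>}"
      by (simp add: image_Suc_lessThan)
    then have "(\<lambda>p. \<pi> ! (p - 1)) ` {1..length \<pi>} = (\<lambda>i. \<pi> ! i) ` {..<length \<pi>}"
      by (simp add: image_image)
    also have "\<dots> = set \<pi>"
      by (auto simp: set_conv_nth)
    finally show "(\<lambda>p. \<pi> ! (p - 1)) ` {1..length \<pi>} = {1..length \<pi>}"
      using s by simp
  qed
  then have "bij_betw (perm_fun \<pi>) {1..length \<pi>} {1..length \<pi>}"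
    by (rule bij_betw_cong[THEN iffD1, rotated]) (simp add: perm_fun_def entry_def)
  then show ?thesis
    by (rule bij_imp_permutes) (auto simp: perm_fun_def)
qed

text \<open>Fixed points outside \<open>{1..n}\<close> increase among themselves and lie below and
  to the left, or above and to the right, of all points inside, so none takes part in an
  inversion.\<close>

lemma permutes_inversion_in:
  fixes f :: "nat \<Rightarrow> nat"
  assumes "f permutes {1..n}" "p < q" "f q < f p"
  shows "p \<in> {1..n}" "q \<in> {1..n}"
proof -
  have out: "f r = r" if "r \<notin> {1..n}" for r
    using assms(1) that by (rule permutes_not_in)
  have ins: "f r \<in> {1..n}" if "r \<in> {1..n}" for r
    using permutes_in_image[OF assms(1)] that by blast
  show p: "p \<in> {1..n}"
  proof (rule ccontr)
    assume "p \<notin> {1..n}"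
    then show False using out[of p] out[of q] ins[of q] assms(2,3) by force
  qed
  show "q \<in> {1..n}"
  proof (rule ccontr)
    assume "q \<notin> {1..n}"
    then show False using p out[of q] ins[of p] assms(2,3) by force
  qed
qed

lemma subseq_Cons_iff:
  "subseq (x # xs) ys \<longleftrightarrow> (\<exists>i < length ys. ys ! i = x \<and> subseq xs (drop (Suc i) ys))"
proof
  assume "subseq (x # xs) ys"
  then obtain us vs where "ys = us @ x # vs" "subseq xs vs"
    by (auto dest: list_emb_ConsD)
  then show "\<exists>i < length ys. ys ! i = x \<and> subseq xs (drop (Suc i) ys)"
    by (intro exI[of _ "length us"]) auto
next
  assume "\<exists>i < length ys. ys ! i = x \<and> subseq xs (drop (Suc i) ys)"
  then obtain i where i: "i < length ys" "ys ! i = x" "subseq xs (drop (Suc i) ys)" by blast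
  then have "subseq (x # xs) (take i ys @ x # drop (Suc i) ys)"
    by (intro list_emb_append2) auto
  then show "subseq (x # xs) ys"
    using id_take_nth_drop[OF i(1)] i(2) by simp
qed

text \<open>The index \<open>i\<close> refers to the whole list, not to the remaining suffix, so
  repeated application builds a subsequence from increasing indices.\<close>

lemma subseq_Cons_dropI:
  assumes "m \<le> i" "i < length ys" "subseq xs (drop (Suc i) ys)"
  shows "subseq (ys ! i # xs) (drop m ys)"
  unfolding subseq_Cons_iff using assms by (intro exI[of _ "i - m"]) auto

lemma contains_pattern_4_iff:
  "contains_pattern \<pi> [a, b, c, d] \<longleftrightarrow>
     (\<exists>i j k l. i < j \<and> j < k \<and> k < l \<and> l < length \<pi> \<and>
        order_isomorphic [\<pi> ! i, \<pi> ! j, \<pi> ! k, \<pi> ! l] [a, b, c, d])"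
proof
  assume "contains_pattern \<pi> [a, b, c, d]"
  then obtain xs where xs: "subseq xs \<pi>" "order_isomorphic xs [a, b, c, d]"
    by (auto simp: contains_pattern_def)
  then have "length xs = 4" by (simp add: order_isomorphic_def)
  then obtain w x y z where wxyz: "xs = [w, x, y, z]"
    by (auto simp: numeral_eq_Suc length_Suc_conv)
  \<comment> \<open>Each new index is an offset into the suffix left by the previous one; the true
    indices are the shifted sums.\<close>
  then obtain i j k l where *: "i < length \<pi>" "\<pi> ! i = w"
     "j < length \<pi> - Suc i" "\<pi> ! (Suc i + j) = x"
     "k < length \<pi> - Suc i - Suc j" "\<pi> ! (Suc i + Suc j + k) = y"
     "l < length \<pi> - Suc i - Suc j - Suc k" "\<pi> ! (Suc i + Suc j + Suc k + l) = z"
    using xs(1) by (auto simp: subseq_Cons_iff add_ac)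
  have "order_isomorphic [\<pi> ! i, \<pi> ! (Suc i + j), \<pi> ! (Suc i + Suc j + k),
      \<pi> ! (Suc i + Suc j + Suc k + l)] [a, b, c, d]"
    unfolding * using xs(2) wxyz by simp
  moreover have "i < Suc i + j" "Suc i + j < Suc i + Suc j + k"
    "Suc i + Suc j + k < Suc i + Suc j + Suc k + l" "Suc i + Suc j + Suc k + l < length \<pi>"
    using * by linarith+
  ultimately show "\<exists>i j k l. i < j \<and> j < k \<and> k < l \<and> l < length \<pi> \<and>
        order_isomorphic [\<pi> ! i, \<pi> ! j, \<pi> ! k, \<pi> ! l] [a, b, c, d]"
    by blast
next
  assume "\<exists>i j k l. i < j \<and> j < k \<and> k < l \<and> l < length \<pi> \<and>
        order_isomorphic [\<pi> ! i, \<pi> ! j, \<pi> ! k, \<pi> ! l] [a, b, c, d]"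
  then obtain i j k l where *: "i < j" "j < k" "k < l" "l < length \<pi>"
        "order_isomorphic [\<pi> ! i, \<pi> ! j, \<pi> ! k, \<pi> ! l] [a, b, c, d]" by blast
  have "subseq [\<pi> ! i, \<pi> ! j, \<pi> ! k, \<pi> ! l] (drop 0 \<pi>)"
    using *(1-4) by (intro subseq_Cons_dropI) simp_all
  then show "contains_pattern \<pi> [a, b, c, d]"
    using * by (auto simp: contains_pattern_def)
qed

lemma order_isomorphic_4321:
  "order_isomorphic [a, b, c, d] [4, 3, 2, 1] \<longleftrightarrow> d < c \<and> c < b \<and> b < a"
  by (auto simp: order_isomorphic_def numeral_eq_Suc All_less_Suc)

lemma order_isomorphic_2143:
  "order_isomorphic [a, b, c, d] [2, 1, 4, 3] \<longleftrightarrow> b < a \<and> a < d \<and> d < c"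
  by (auto simp: order_isomorphic_def numeral_eq_Suc All_less_Suc)

lemma Av_iff:
  "\<pi> \<in> Av {[4, 3, 2, 1], [2, 1, 4, 3]} \<longleftrightarrow> \<pi> \<in> perms \<and> avoids (perm_fun \<pi>)"
proof (cases "\<pi> \<in> perms")
  case True
  let ?f = "perm_fun \<pi>" and ?n = "length \<pi>"
  note f = perm_fun_permutes[OF True]
  have f_Suc: "?f (Suc i) = \<pi> ! i" if "i < ?n" for i
    using that by (simp add: perm_fun_def entry_def)
  have "(\<exists>\<sigma> \<in> {[4, 3, 2, 1], [2, 1, 4, 3]}. contains_pattern \<pi> \<sigma>) \<longleftrightarrow> \<not> avoids ?f"
  proof
    assume "\<exists>\<sigma> \<in> {[4, 3, 2, 1], [2, 1, 4, 3]}. contains_pattern \<pi> \<sigma>"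
    then obtain i j k l where "i < j" "j < k" "k < l" "l < ?n"
      "(\<pi> ! l < \<pi> ! k \<and> \<pi> ! k < \<pi> ! j \<and> \<pi> ! j < \<pi> ! i) \<or>
       (\<pi> ! j < \<pi> ! i \<and> \<pi> ! i < \<pi> ! l \<and> \<pi> ! l < \<pi> ! k)"
      unfolding bex_simps contains_pattern_4_iff order_isomorphic_4321 order_isomorphic_2143
      by blast
    then show "\<not> avoids ?f"
      using f_Suc unfolding avoids_def
      by (intro notI) (drule spec[of _ "Suc i"], drule spec[of _ "Suc j"], drule spec[of _ "Suc k"],
        drule spec[of _ "Suc l"], auto)
  next
    assume "\<not> avoids ?f"
    then obtain i j k l where *: "i < j" "j < k" "k < l"
      "(?f l < ?f k \<and> ?f k < ?f j \<and> ?f j < ?f i) \<or> (?f j < ?f i \<and> ?f i < ?f l \<and> ?f l < ?f k)"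
      by (auto simp: avoids_def)
    \<comment> \<open>In both patterns the first two and the last two entries form inversions, which
      puts all four positions in range.\<close>
    then have "?f j < ?f i" "?f l < ?f k" by auto
    then have "i \<in> {1..?n}" "j \<in> {1..?n}" "k \<in> {1..?n}" "l \<in> {1..?n}"
      using permutes_inversion_in[OF f] * by blast+
    then have "?f i = \<pi> ! (i - 1)" "?f j = \<pi> ! (j - 1)" "?f k = \<pi> ! (k - 1)" "?f l = \<pi> ! (l - 1)"
      "i - 1 < j - 1" "j - 1 < k - 1" "k - 1 < l - 1" "l - 1 < ?n"
      using *(1-3) by (auto simp: perm_fun_def entry_def)
    with *(4) show "\<exists>\<sigma> \<in> {[4, 3, 2, 1], [2, 1, 4, 3]}. contains_pattern \<pi> \<sigma>"
      unfolding bex_simps contains_pattern_4_iff order_isomorphic_4321 order_isomorphic_2143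
      by metis
  qed
  with True show ?thesis by (auto simp: Av_def)
qed (simp add: Av_def)

section \<open>Cuts versus column and row indices\<close>

text \<open>By monotonicity \<open>{q \<in> {1..n}. h q \<le> i}\<close> is an initial segment,
  hence determined by its maximum; the inserted 0 covers the empty segment.\<close>

lemma mono_on_Max_iff:
  fixes h :: "nat \<Rightarrow> nat"
  assumes "mono_on {1..n} h" "p \<in> {1..n}"
  shows "p \<le> Max (insert 0 {q \<in> {1..n}. h q \<le> i}) \<longleftrightarrow> h p \<le> i"
proof
  let ?A = "insert 0 {q \<in> {1..n}. h q \<le> i}"
  assume p: "p \<le> Max ?A"
  have "Max ?A \<in> ?A" by (rule Max_in) auto
  then have "Max ?A \<in> {1..n}" "h (Max ?A) \<le> i" using p assms(2) by auto
  then show "h p \<le> i"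
    using assms p by (meson mono_onD order_trans)
next
  assume "h p \<le> i"
  with assms(2) show "p \<le> Max (insert 0 {q \<in> {1..n}. h q \<le> i})"
    by (intro Max_ge) auto
qed

text \<open>The cut \<open>c i\<close> is the last position of index at most \<open>i\<close>; the
  bounds 1 and \<open>k\<close> on the indices give the end cuts 0 and \<open>n\<close>.\<close>

lemma ex_cuts:
  assumes mono: "mono_on {1..n} h" and range: "\<And>p. p \<in> {1..n} \<Longrightarrow> h p \<in> {1..k}"
  shows "\<exists>c :: nat \<Rightarrow> nat. c 0 = 0 \<and> c k = n \<and> mono_on {0..k} c \<and>
    (\<forall>p \<in> {1..n}. \<forall>i \<in> {1..k}. c (i - 1) < p \<and> p \<le> c i \<longleftrightarrow> h p = i)"
proof -
  let ?c = "\<lambda>i. Max (insert 0 {q \<in> {1..n}. h q \<le> i})"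
  have empty: "{q \<in> {1..n}. h q \<le> 0} = {}" using range by force
  have c0: "?c 0 = 0" unfolding empty by simp
  have "{q \<in> {1..n}. h q \<le> k} = {1..n}" using range by auto
  moreover have "Max (insert 0 {1..n}) = n" by (rule Max_eqI) auto
  ultimately have ck: "?c k = n" by simp
  have mc: "mono_on {0..k} ?c"
    by (intro mono_onI Max_mono) auto
  have "?c (i - 1) < p \<and> p \<le> ?c i \<longleftrightarrow> h p = i" if p: "p \<in> {1..n}" and i: "i \<in> {1..k}" for p i
  proof -
    have "?c (i - 1) < p \<longleftrightarrow> \<not> h p \<le> i - 1"
      using mono_on_Max_iff[OF mono p, of "i - 1"] by linarith
    moreover have "p \<le> ?c i \<longleftrightarrow> h p \<le> i"
      by (rule mono_on_Max_iff[OF mono p])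
    ultimately show ?thesis
      using i by auto
  qed
  with c0 ck mc show ?thesis by (intro exI[of _ ?c]) blast
qed

text \<open>The index of \<open>p\<close> is the least \<open>i\<close> with
  \<open>p \<le> c i\<close>; minimality gives both monotonicity and the strict lower bound.\<close>

lemma ex_index:
  fixes c :: "nat \<Rightarrow> nat"
  assumes "c 0 = 0" "c k = n"
  shows "\<exists>h. mono_on {1..n} h \<and>
    (\<forall>p \<in> {1..n}. h p \<in> {1..k} \<and> c (h p - 1) < p \<and> p \<le> c (h p))"
proof -
  let ?h = "\<lambda>p. LEAST i. p \<le> c i"
  have k: "p \<le> c k" if "p \<in> {1..n}" for p using that assms(2) by simp
  have h: "p \<le> c (?h p)" if "p \<in> {1..n}" for p using k[OF that] by (rule LeastI)
  have m: "mono_on {1..n} ?h"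
  proof (rule mono_onI)
    fix p q assume "p \<in> {1..n}" "q \<in> {1..n}" "p \<le> q"
    with h[of q] show "?h p \<le> ?h q" by (intro Least_le) simp
  qed
  have "?h p \<in> {1..k} \<and> c (?h p - 1) < p \<and> p \<le> c (?h p)" if p: "p \<in> {1..n}" for p
  proof -
    have *: "p \<le> c (?h p)" by (rule h[OF p])
    have pos: "?h p \<noteq> 0" using * p assms(1) by (metis atLeastAtMost_iff le_zero_eq not_one_le_zero)
    moreover have "?h p \<le> k" by (rule Least_le) (rule k[OF p])
    ultimately have "?h p \<in> {1..k}" by simp
    moreover have "c (?h p - 1) < p"
      using not_less_Least[of "?h p - 1" "\<lambda>i. p \<le> c i"] pos by simp
    ultimately show ?thesis using * by blast
  qed
  with m show ?thesis by blast
qed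

text \<open>Translates the list-based grid classes into \<open>gridded\<close>:
  \<open>ex_index\<close> turns cuts into index maps and \<open>ex_cuts\<close> goes back.\<close>

lemma grid_class_iff:
  assumes S: "S \<subseteq> {1..k} \<times> {1..l}"
  shows "\<pi> \<in> grid_class k l (increasing_cells S) \<longleftrightarrow>
    \<pi> \<in> perms \<and> gridded S (length \<pi>) (perm_fun \<pi>)"
proof (cases "\<pi> \<in> perms")
  case True
  let ?f = "perm_fun \<pi>" and ?n = "length \<pi>"
  note f = perm_fun_permutes[OF True]
  have ent: "?f p = entry \<pi> p" if "p \<in> {1..?n}" for p
    using that by (simp add: perm_fun_def)
  have rng: "?f p \<in> {1..?n}" if "p \<in> {1..?n}" for p
    using permutes_in_image[OF f] that by blast
  show ?thesis
  proof
    assume "\<pi> \<in> grid_class k l (increasing_cells S)"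
    then obtain c r where c: "c 0 = 0" "c k = ?n" and r: "r 0 = 0" "r l = ?n"
      and fits: "\<And>i j. i \<in> {1..k} \<Longrightarrow> j \<in> {1..l} \<Longrightarrow> fits_cell (increasing_cells S (i, j)) \<pi>
          {p. c (i - 1) < p \<and> p \<le> c i \<and> r (j - 1) < entry \<pi> p \<and> entry \<pi> p \<le> r j}"
      unfolding grid_class_def by blast
    obtain col where col: "mono_on {1..?n} col"
      "\<And>p. p \<in> {1..?n} \<Longrightarrow> col p \<in> {1..k} \<and> c (col p - 1) < p \<and> p \<le> c (col p)"
      using ex_index[OF c] by blast
    obtain row where row: "mono_on {1..?n} row"
      "\<And>p. p \<in> {1..?n} \<Longrightarrow> row p \<in> {1..l} \<and> r (row p - 1) < p \<and> p \<le> r (row p)"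
      using ex_index[OF r] by blast
    have *: "p \<in> {p. c (col p - 1) < p \<and> p \<le> c (col p) \<and>
        r (row (?f p) - 1) < entry \<pi> p \<and> entry \<pi> p \<le> r (row (?f p))}" if "p \<in> {1..?n}" for p
      using col(2)[OF that] row(2)[OF rng[OF that]] ent[OF that] by simp
    have **: "fits_cell (increasing_cells S (col p, row (?f p))) \<pi>
          {q. c (col p - 1) < q \<and> q \<le> c (col p) \<and>
            r (row (?f p) - 1) < entry \<pi> q \<and> entry \<pi> q \<le> r (row (?f p))}" if "p \<in> {1..?n}" for p
      using fits[of "col p" "row (?f p)"] col(2)[OF that] row(2)[OF rng[OF that]] by blast
    \<comment> \<open>The cell of \<open>p\<close> contains \<open>p\<close> itself, so it cannot be
      an empty cell.\<close>
    have in_S: "(col p, row (?f p)) \<in> S" if "p \<in> {1..?n}" for p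
      using *[OF that] **[OF that] by (auto simp: increasing_cells_def fits_cell_def split: if_splits)
    moreover have "?f p < ?f q" if "p \<in> {1..?n}" "q \<in> {1..?n}" "p < q" "col p = col q"
        "row (?f p) = row (?f q)" for p q
      using *[OF that(1)] *[OF that(2)] **[OF that(1)] in_S[OF that(1)] that ent
      by (auto simp: increasing_cells_def fits_cell_def strict_mono_on_def)
    ultimately show "\<pi> \<in> perms \<and> gridded S ?n ?f"
      unfolding gridded_def using True col(1) row(1) by blast
  next
    assume "\<pi> \<in> perms \<and> gridded S ?n ?f"
    then obtain col row where mono: "mono_on {1..?n} col" "mono_on {1..?n} row"
      and in_S: "\<And>p. p \<in> {1..?n} \<Longrightarrow> (col p, row (?f p)) \<in> S"
      and inc: "\<And>p q. p \<in> {1..?n} \<Longrightarrow> q \<in> {1..?n} \<Longrightarrow> p < q \<Longrightarrow> col p = col q \<Longrightarrow>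
        row (?f p) = row (?f q) \<Longrightarrow> ?f p < ?f q"
      unfolding gridded_def by blast
    have "col p \<in> {1..k}" if "p \<in> {1..?n}" for p using in_S[OF that] S by blast
    then obtain c where c: "c 0 = 0" "c k = ?n" "mono_on {0..k} c"
      "\<And>p i. p \<in> {1..?n} \<Longrightarrow> i \<in> {1..k} \<Longrightarrow> c (i - 1) < p \<and> p \<le> c i \<longleftrightarrow> col p = i"
      using ex_cuts[OF mono(1), of k] by blast
    \<comment> \<open>\<open>in_S\<close> bounds the rows of values \<open>f p\<close> only;
      surjectivity reaches every value.\<close>
    have "row v \<in> {1..l}" if v: "v \<in> {1..?n}" for v
    proof -
      obtain p where "p \<in> {1..?n}" "v = ?f p" using v permutes_image[OF f] by blast
      then show ?thesis using in_S[of p] S by blast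
    qed
    then obtain r where r: "r 0 = 0" "r l = ?n" "mono_on {0..l} r"
      "\<And>p i. p \<in> {1..?n} \<Longrightarrow> i \<in> {1..l} \<Longrightarrow> r (i - 1) < p \<and> p \<le> r i \<longleftrightarrow> row p = i"
      using ex_cuts[OF mono(2), of l] by blast
    have "fits_cell (increasing_cells S (i, j)) \<pi>
        {p. c (i - 1) < p \<and> p \<le> c i \<and> r (j - 1) < entry \<pi> p \<and> entry \<pi> p \<le> r j}"
        (is "fits_cell _ _ ?P") if ij: "i \<in> {1..k}" "j \<in> {1..l}" for i j
    proof -
      \<comment> \<open>Points of a cell are described by cuts alone; this bound places their
        positions in \<open>{1..n}\<close>.\<close>
      have "c i \<le> ?n" using c(2,3) ij(1) by (auto dest: mono_onD[of _ _ i k])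
      then have dom: "p \<in> {1..?n}" if "p \<in> ?P" for p using that by auto
      have cell: "col p = i \<and> row (?f p) = j" if "p \<in> ?P" for p
        using c(4)[OF dom[OF that] ij(1)] r(4)[OF rng[OF dom[OF that]] ij(2)] that
          ent[OF dom[OF that]] by auto
      show ?thesis
      proof (cases "(i, j) \<in> S")
        case True
        have "strict_mono_on ?P (entry \<pi>)"
        proof (rule strict_mono_onI)
          fix p q assume pq: "p \<in> ?P" "q \<in> ?P" "p < q"
          show "entry \<pi> p < entry \<pi> q"
            using inc[OF dom[OF pq(1)] dom[OF pq(2)] pq(3)] cell[OF pq(1)] cell[OF pq(2)]
              ent[OF dom[OF pq(1)]] ent[OF dom[OF pq(2)]] by simp
        qed
        with True show ?thesis by (simp add: increasing_cells_def fits_cell_def)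
      next
        case False
        have "?P = {}"
        proof (rule equals0I)
          fix p assume "p \<in> ?P"
          then show False using cell in_S dom False by fastforce
        qed
        with False show ?thesis by (simp add: increasing_cells_def fits_cell_def)
      qed
    qed
    then show "\<pi> \<in> grid_class k l (increasing_cells S)"
      unfolding grid_class_def using True c(1-3) r(1-3) by blast
  qed
qed (simp add: grid_class_def)

section \<open>Symmetry under inversion\<close>

text \<open>Inversion reflects the plot in the diagonal: columns and rows trade places while
  increasing cells stay increasing.\<close>

lemma gridded_inv:
  assumes f: "f permutes {1..n}" and g: "gridded S n (inv f)"
  shows "gridded (S\<inverse>) n f"
proof -
  obtain col row where mono: "mono_on {1..n} col" "mono_on {1..n} row"
    and S: "\<And>v. v \<in> {1..n} \<Longrightarrow> (col v, row (inv f v)) \<in> S"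
    and inc: "\<And>v w. v \<in> {1..n} \<Longrightarrow> w \<in> {1..n} \<Longrightarrow> v < w \<Longrightarrow> col v = col w \<Longrightarrow>
      row (inv f v) = row (inv f w) \<Longrightarrow> inv f v < inv f w"
    using g unfolding gridded_def by blast
  have inv: "inv f (f p) = p" for p using permutes_inverses(2)[OF f] .
  have rng: "f p \<in> {1..n}" if "p \<in> {1..n}" for p
    using permutes_in_image[OF f] that by blast
  have "(row p, col (f p)) \<in> S\<inverse>" if "p \<in> {1..n}" for p
    using S[OF rng[OF that]] inv by simp
  moreover have "f p < f q" if "p \<in> {1..n}" "q \<in> {1..n}" "p < q" "row p = row q"
    "col (f p) = col (f q)" for p q
  proof (rule ccontr)
    assume "\<not> f p < f q"
    moreover have "f p \<noteq> f q" using \<open>p < q\<close> inv by (metis less_irrefl)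
    ultimately have "f q < f p" by simp
    from inc[OF rng[OF that(2)] rng[OF that(1)] this] that(3-5) inv show False by simp
  qed
  ultimately show ?thesis
    unfolding gridded_def using mono by blast
qed

text \<open>Both 4321 and 2143 are involutions, so an occurrence in \<open>inv f\<close> is, read by
  values, an occurrence of the same pattern in \<open>f\<close>.\<close>

lemma avoids_inv:
  assumes f: "f permutes S" and "avoids f"
  shows "avoids (inv f)"
proof -
  have inv: "f (inv f v) = v" for v using permutes_inverses(1)[OF f] .
  show ?thesis
    unfolding avoids_def
  proof (intro allI impI)
    fix i j k l :: nat assume *: "i < j \<and> j < k \<and> k < l"
    have "\<not> (inv f l < inv f k \<and> inv f k < inv f j \<and> inv f j < inv f i)"
      using assms(2) * inv unfolding avoids_def by metis
    moreover have "\<not> (inv f j < inv f i \<and> inv f i < inv f l \<and> inv f l < inv f k)"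
      using assms(2) * inv unfolding avoids_def by metis
    ultimately show "\<not> (inv f l < inv f k \<and> inv f k < inv f j \<and> inv f j < inv f i) \<and>
      \<not> (inv f j < inv f i \<and> inv f i < inv f l \<and> inv f l < inv f k)" by blast
  qed
qed

section \<open>Explicit griddings\<close>

definition A_cells :: "(nat \<times> nat) set" where
  "A_cells = {(1,1), (2,3), (3,2), (3,3)}"

definition B_cells :: "(nat \<times> nat) set" where
  "B_cells = {(1,1), (1,2), (2,1), (3,3)}"

text \<open>Class D uses the converse of this relation.\<close>

definition C_cells :: "(nat \<times> nat) set" where
  "C_cells = {(1,1), (2,3), (3,4), (4,2), (5,3), (6,1), (7,2), (8,4)}"

text \<open>Every column holds a single cell. The left run fills columns 1 to 3 (rows 1, 3, 4), the
  middle run columns 4 and 5 (rows 2, 3), the right run columns 6 to 8 (rows 1, 2, 4). Avoidance of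
  2143 serves to keep the right run out of row 3.\<close>

lemma gridded_C:
  assumes f: "f permutes {1..n}" and av: "avoids f"
    and d: "d1 < d2" "d2 \<le> n"
    and inc1: "\<And>p q. 1 \<le> p \<Longrightarrow> p < q \<Longrightarrow> q \<le> d1 \<Longrightarrow> f p < f q"
    and inc2: "\<And>p q. d1 < p \<Longrightarrow> p < q \<Longrightarrow> q \<le> d2 \<Longrightarrow> f p < f q"
    and inc3: "\<And>p q. d2 < p \<Longrightarrow> p < q \<Longrightarrow> q \<le> n \<Longrightarrow> f p < f q"
  shows "gridded C_cells n f"
proof -
  \<comment> \<open>Rows 1 and 4 lie below and above the values of the middle run; row 3 starts at the smallest
    value of the left run that is not in row 1.\<close>
  define lo hi where "lo = f (Suc d1)" and "hi = f d2"
  define above where "above v \<longleftrightarrow> (\<exists>p \<in> {1..d1}. lo \<le> f p \<and> f p \<le> v)" for v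
  define row where "row v = (if v < lo then 1 else if hi < v then 4 else if above v then 3 else 2 :: nat)" for v
  define col where "col p = (if p \<le> d1 then (if row (f p) = 1 then 1 else if row (f p) \<le> 3 then 2 else 3)
     else if p \<le> d2 then (if row (f p) = 2 then 4 else 5)
     else if row (f p) = 1 then 6 else if row (f p) = 2 then 7 else 8 :: nat)" for p
  have middle: "lo \<le> f p \<and> f p \<le> hi" if "d1 < p" "p \<le> d2" for p
    using inc2[of "Suc d1" p] inc2[of p d2] that d unfolding lo_def hi_def
    by (cases "p = Suc d1"; cases "p = d2") (auto intro: less_imp_le)
  have above_mono: "above w" if "above v" "v \<le> w" for v w
    using that unfolding above_def by (meson order_trans)
  have row_mono: "row v \<le> row w" if "v \<le> w" for v w
    using that above_mono[of v w] by (auto simp: row_def)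
  have left: "row (f p) \<noteq> 2" if "p \<in> {1..d1}" for p
  proof -
    \<comment> \<open>A left value that is at least \<open>lo\<close> is its own witness for
      \<open>above\<close>.\<close>
    have "above (f p)" if "lo \<le> f p" using that \<open>p \<in> {1..d1}\<close> by (auto simp: above_def)
    then show ?thesis by (auto simp: row_def)
  qed
  have inj: "f p = f q \<longleftrightarrow> p = q" for p q
    using permutes_inj[OF f] by (auto dest: injD)
  have right: "row (f q) \<noteq> 3" if q: "d2 < q" "q \<le> n" for q
  proof
    assume "row (f q) = 3"
    then obtain p where p: "p \<in> {1..d1}" "lo \<le> f p" "f p \<le> f q" and hi: "f q \<le> hi"
      by (auto simp: row_def above_def split: if_splits)
    have "f p \<noteq> lo" "f p \<noteq> f q" "f q \<noteq> hi" using p(1) q d by (auto simp: lo_def hi_def inj)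
    then have *: "lo < f p" "f p < f q" "f q < hi" using p hi by auto
    \<comment> \<open>Since \<open>lo < hi\<close>, the middle run has two distinct ends, and
      \<open>p\<close>, \<open>Suc d1\<close>, \<open>d2\<close>, \<open>q\<close> carry
      2143.\<close>
    then have "Suc d1 \<noteq> d2" by (auto simp: lo_def hi_def)
    then have "p < Suc d1" "Suc d1 < d2" "d2 < q" using p(1) q d by auto
    then show False using av * unfolding avoids_def lo_def hi_def by blast
  qed
  have r: "row v \<in> {1, 2, 3, 4}" for v by (simp add: row_def)
  have mid: "row (f p) \<in> {2, 3}" if "d1 < p" "p \<le> d2" for p
    using middle[OF that] by (auto simp: row_def)
  have cells: "(col p, row (f p)) \<in> C_cells" if "p \<in> {1..n}" for p
    using r[of "f p"] mid[of p] left[of p] right[of p] that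
    by (cases "p \<le> d1"; cases "p \<le> d2") (auto simp: col_def C_cells_def)
  have col_mono: "col p \<le> col q" if pq: "p \<in> {1..n}" "q \<in> {1..n}" "p < q" for p q
  proof -
    \<comment> \<open>Within a run \<open>f\<close> increases, so rows and hence columns do;
      different runs occupy consecutive blocks of columns.\<close>
    have "row (f p) \<le> row (f q)" if "(p \<le> d1 \<longleftrightarrow> q \<le> d1) \<and> (p \<le> d2 \<longleftrightarrow> q \<le> d2)"
      using that pq inc1[of p q] inc2[of p q] inc3[of p q] row_mono[of "f p" "f q"] by fastforce
    then show ?thesis
      using pq d r[of "f p"] r[of "f q"] mid[of p] mid[of q] left[of p] left[of q] right[of p] right[of q]
      by (auto simp: col_def)
  qed
  \<comment> \<open>Each column lies inside one increasing run.\<close>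
  have same_col: "f p < f q" if pq: "p \<in> {1..n}" "q \<in> {1..n}" "p < q" "col p = col q" for p q
  proof -
    have "(p \<le> d1 \<longleftrightarrow> q \<le> d1) \<and> (p \<le> d2 \<longleftrightarrow> q \<le> d2)"
      using pq(4) d(1) by (auto simp: col_def split: if_splits)
    then show ?thesis
      using pq inc1[of p q] inc2[of p q] inc3[of p q] by fastforce
  qed
  have "mono_on {1..n} col"
    by (rule mono_onI) (metis col_mono le_neq_implies_less order_refl)
  moreover have "mono_on {1..n} row" using row_mono by (auto intro!: mono_onI)
  ultimately show ?thesis
    unfolding gridded_def using cells same_col by blast
qed

text \<open>Up to position \<open>a\<close> the values increase, so those at most \<open>b\<close>
  come first and columns 1 and 2 are separated by a cut; rows 1 and 2 likewise through the inverse.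
  Cells (1,1) and (2,3) increase by \<open>inc\<close>, (3,2) by \<open>inv_inc\<close>, and
  \<open>ne\<close> handles the north-east cell (3,3).\<close>

lemma gridded_A:
  assumes f: "f permutes {1..n}"
    and inc: "\<And>p q. p < q \<Longrightarrow> q \<le> a \<Longrightarrow> f p < f q"
    and inv_inc: "\<And>v w. v < w \<Longrightarrow> w \<le> b \<Longrightarrow> inv f v < inv f w"
    and ne: "\<And>p q. a < p \<Longrightarrow> p < q \<Longrightarrow> b < f p \<Longrightarrow> b < f q \<Longrightarrow> f p < f q"
  shows "gridded A_cells n f"
proof -
  define col where "col p = (if a < p then 3 else if f p \<le> b then 1 else 2 :: nat)" for p
  define row where "row v = (if b < v then 3 else if inv f v \<le> a then 1 else 2 :: nat)" for v
  have inv: "inv f (f p) = p" for p using permutes_inverses(2)[OF f] .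
  have "col p \<le> col q" if "p \<le> q" for p q
    using inc[of p q] that by (cases "p = q"; cases "q \<le> a"; cases "a < p") (auto simp: col_def)
  then have "mono_on {1..n} col" by (auto intro!: mono_onI)
  moreover have "row v \<le> row w" if "v \<le> w" for v w
    using inv_inc[of v w] that by (cases "v = w"; cases "w \<le> b"; cases "b < v") (auto simp: row_def)
  then have "mono_on {1..n} row" by (auto intro!: mono_onI)
  moreover have "(col p, row (f p)) \<in> A_cells" for p
    using inv[of p] by (auto simp: col_def row_def A_cells_def)
  moreover have "f p < f q" if "p < q" "col p = col q" "row (f p) = row (f q)" for p q
  proof (rule ccontr)
    assume "\<not> f p < f q"
    moreover have "f p \<noteq> f q" using inv \<open>p < q\<close> by (metis less_irrefl)
    ultimately have "f q < f p" by simp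
    then show False
      using that inc[of p q] inv_inc[of "f q" "f p"] ne[of p q] inv[of p] inv[of q]
      by (auto simp: col_def row_def not_less split: if_splits)
  qed
  ultimately show ?thesis
    unfolding gridded_def by blast
qed

text \<open>The picture of class A rotated by a half turn: beyond \<open>a\<close> the values
  increase, which separates columns 2 and 3, and \<open>sw\<close> handles the south-west cell
  (1,1).\<close>

lemma gridded_B:
  assumes f: "f permutes {1..n}"
    and inc: "\<And>p q. p < q \<Longrightarrow> a < p \<Longrightarrow> f p < f q"
    and inv_inc: "\<And>v w. v < w \<Longrightarrow> b < v \<Longrightarrow> inv f v < inv f w"
    and sw: "\<And>p q. q \<le> a \<Longrightarrow> p < q \<Longrightarrow> f p \<le> b \<Longrightarrow> f q \<le> b \<Longrightarrow> f p < f q"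
  shows "gridded B_cells n f"
proof -
  define col where "col p = (if p \<le> a then 1 else if f p \<le> b then 2 else 3 :: nat)" for p
  define row where "row v = (if v \<le> b then 1 else if inv f v \<le> a then 2 else 3 :: nat)" for v
  have inv: "inv f (f p) = p" for p using permutes_inverses(2)[OF f] .
  have "col p \<le> col q" if "p \<le> q" for p q
    using inc[of p q] that by (cases "p = q"; cases "q \<le> a"; cases "a < p") (auto simp: col_def)
  then have "mono_on {1..n} col" by (auto intro!: mono_onI)
  moreover have "row v \<le> row w" if "v \<le> w" for v w
    using inv_inc[of v w] that by (cases "v = w"; cases "w \<le> b"; cases "b < v") (auto simp: row_def)
  then have "mono_on {1..n} row" by (auto intro!: mono_onI)
  moreover have "(col p, row (f p)) \<in> B_cells" for p
    using inv[of p] by (auto simp: col_def row_def B_cells_def)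
  moreover have "f p < f q" if "p < q" "col p = col q" "row (f p) = row (f q)" for p q
  proof (rule ccontr)
    assume "\<not> f p < f q"
    moreover have "f p \<noteq> f q" using inv \<open>p < q\<close> by (metis less_irrefl)
    ultimately have "f q < f p" by simp
    then show False
      using that inc[of p q] inv_inc[of "f q" "f p"] sw[of q p] inv[of p] inv[of q]
      by (auto simp: col_def row_def split: if_splits)
  qed
  ultimately show ?thesis
    unfolding gridded_def by blast
qed

section \<open>Descents and increasing runs\<close>

definition descents :: "(nat \<Rightarrow> nat) \<Rightarrow> nat set" where
  "descents f = {p. f (Suc p) < f p}"

lemma descents_subset:
  assumes "f permutes {1..n}"
  shows "descents f \<subseteq> {1..<n}"
proof
  fix p assume "p \<in> descents f"
  then have "p \<in> {1..n}" "Suc p \<in> {1..n}"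
    using permutes_inversion_in[OF assms, of p "Suc p"] by (auto simp: descents_def)
  then show "p \<in> {1..<n}" by simp
qed

lemma less_if_no_descents:
  assumes f: "f permutes S" and "p < q" and "descents f \<inter> {p..<q} = {}"
  shows "f p < f q"
  using assms(2,3)
proof (induction q)
  case (Suc q)
  have "q \<notin> descents f" using Suc.prems by auto
  then have "\<not> f (Suc q) < f q" by (simp add: descents_def)
  moreover have "f (Suc q) \<noteq> f q"
    using permutes_inj[OF f] by (metis injD n_not_Suc_n)
  ultimately have "f q < f (Suc q)" by simp
  moreover have "f p < f q" if "p < q"
    using Suc.prems(2) by (intro Suc.IH[OF that]) auto
  ultimately show ?case using Suc.prems(1) by (cases "p = q") simp_all
qed simp

text \<open>\<open>a\<close> and \<open>c\<close> are the extreme elements, which will delimit the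
  first and last run; removing at most two extremes leaves some \<open>b\<close>.\<close>

lemma three_elements:
  fixes D :: "nat set"
  assumes "finite D" "2 < card D"
  obtains a b c where "a \<in> D" "b \<in> D" "c \<in> D" "a < b" "b < c" "\<And>d. d \<in> D \<Longrightarrow> a \<le> d \<and> d \<le> c"
proof -
  have ne: "D \<noteq> {}" using assms by auto
  have "card (D - {Min D, Max D}) \<ge> card D - card {Min D, Max D}"
    by (rule diff_card_le_card_Diff) simp
  moreover have "card {Min D, Max D} \<le> 2" by (auto intro: order_trans[OF card_insert_le_m1])
  ultimately have "D - {Min D, Max D} \<noteq> {}" using assms(2) by force
  then obtain b where "b \<in> D" "b \<noteq> Min D" "b \<noteq> Max D" by blast
  then show ?thesis
    using assms(1) ne by (intro that[of "Min D" b "Max D"]) (auto simp: order.strict_iff_order)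
qed

lemma gridded_C_if_few_descents:
  assumes f: "f permutes {1..n}" and av: "avoids f" and card: "card (descents f) \<le> 2"
  shows "gridded C_cells n f"
proof (cases "n = 0")
  \<comment> \<open>Here there is no room for cuts with \<open>d1 < d2\<close> and
    \<open>d2 \<le> n\<close>.\<close>
  case True
  then show ?thesis by (auto simp: gridded_def mono_on_def)
next
  case False
  note sub = descents_subset[OF f]
  have "\<exists>d1 d2. d1 < d2 \<and> d2 \<le> n \<and> descents f \<subseteq> {d1, d2}"
  proof -
    have "finite (descents f)" using sub finite_subset by blast
    consider "card (descents f) = 0" | "card (descents f) = 1" | "card (descents f) = 2"
      using card by linarith
    then show ?thesis
    proof cases
      case 1
      then have "descents f = {}" using \<open>finite _\<close> by simp
      \<comment> \<open>Missing descents are replaced by the end cuts 0 and \<open>n\<close>, which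
        make outer runs empty.\<close>
      with False show ?thesis by (intro exI[of _ 0] exI[of _ n]) auto
    next
      case 2
      then obtain a where "descents f = {a}" by (auto simp: card_1_singleton_iff)
      with sub show ?thesis by (intro exI[of _ a] exI[of _ n]) auto
    next
      case 3
      then obtain a b where "descents f = {a, b}" "a \<noteq> b" by (auto simp: card_2_iff)
      with sub show ?thesis
        by (intro exI[of _ "min a b"] exI[of _ "max a b"]) (auto simp: min_def max_def)
    qed
  qed
  then obtain d1 d2 where d: "d1 < d2" "d2 \<le> n" "descents f \<subseteq> {d1, d2}" by blast
  show ?thesis
  proof (rule gridded_C[OF f av d(1,2)])
    show "f p < f q" if "p < q" "q \<le> d1" for p q
      using that d by (intro less_if_no_descents[OF f]) auto
    show "f p < f q" if "d1 < p" "p < q" "q \<le> d2" for p q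
      using that d by (intro less_if_no_descents[OF f]) auto
    show "f p < f q" if "d2 < p" "p < q" for p q
      using that d by (intro less_if_no_descents[OF f]) auto
  qed
qed

text \<open>A descent \<open>a\<close> is the last position of its run: the first run includes
  \<open>a\<close>, while the last run starts only after \<open>b\<close>.\<close>

lemma less_outside_descents:
  assumes f: "f permutes S" and "p < q" "q \<le> a \<or> b < p"
    and D: "\<And>d. d \<in> descents f \<Longrightarrow> a \<le> d \<and> d \<le> b"
  shows "f p < f q"
proof (rule less_if_no_descents[OF f \<open>p < q\<close>], rule equals0I)
  fix d assume "d \<in> descents f \<inter> {p..<q}"
  then have "a \<le> d \<and> d \<le> b" "p \<le> d" "d < q" using D by auto
  then show False using assms(3) by linarith
qed

section \<open>Three descents in both \<open>f\<close> and its inverse\<close>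

text \<open>The inversion \<open>x\<close>, \<open>y\<close> obstructs the gridding of class A cut
  at \<open>a1\<close>, \<open>e1\<close>; the inversion \<open>u\<close>, \<open>w\<close>
  obstructs that of class B cut at \<open>a3\<close>, \<open>e3\<close>. Together with the two
  points of each of the six descents they force 4321 or 2143.\<close>

lemma no_inversions_if_many_descents:
  assumes f: "f permutes {1..n}" and av: "avoids f"
    and a: "a1 \<in> descents f" "a2 \<in> descents f" "a3 \<in> descents f" "a1 < a2" "a2 < a3"
      "\<And>d. d \<in> descents f \<Longrightarrow> a1 \<le> d \<and> d \<le> a3"
    and e: "e1 \<in> descents (inv f)" "e2 \<in> descents (inv f)" "e3 \<in> descents (inv f)" "e1 < e2" "e2 < e3"
      "\<And>d. d \<in> descents (inv f) \<Longrightarrow> e1 \<le> d \<and> d \<le> e3"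
    and xy: "x < y" "f y < f x" "a1 < x" "e1 < f y"
    and uw: "u < w" "f w < f u" "w \<le> a3" "f u \<le> e3"
  shows False
proof -
  \<comment> \<open>Each \<open>b\<close> follows its descent \<open>a\<close>; \<open>s\<close> and
    \<open>c\<close> are the positions of the adjacent values \<open>e\<close> and
    \<open>e + 1\<close>, so a descent of the inverse puts \<open>c\<close> to the left of
    \<open>s\<close>.\<close>
  define b1 b2 b3 where b: "b1 = a1 + 1" "b2 = a2 + 1" "b3 = a3 + 1"
  define s1 s2 s3 where s: "s1 = inv f e1" "s2 = inv f e2" "s3 = inv f e3"
  define c1 c2 c3 where c: "c1 = inv f (Suc e1)" "c2 = inv f (Suc e2)" "c3 = inv f (Suc e3)"
  have f_inv: "f (inv f v) = v" for v using permutes_inverses(1)[OF f] .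
  have inv_f: "inv f (f p) = p" for p using permutes_inverses(2)[OF f] .
  have dec: "\<not> (i < j \<and> j < k \<and> k < l \<and> f j < f i \<and> f k < f j \<and> f l < f k)"
    and two: "\<not> (i < j \<and> j < k \<and> k < l \<and> f j < f i \<and> f i < f l \<and> f l < f k)" for i j k l
    using av unfolding avoids_def by blast+
  have inj: "f p = f q \<longleftrightarrow> p = q" for p q
    using inv_f by metis
  have des: "f b1 < f a1" "f b2 < f a2" "f b3 < f a3"
    using a(1-3) by (simp_all add: b descents_def)
  have ides: "f c1 = f s1 + 1" "f c2 = f s2 + 1" "f c3 = f s3 + 1" "c1 < s1" "c2 < s2" "c3 < s3"
    "f s1 < f s2" "f s2 < f s3"
    using e(1-5) by (simp_all add: c s f_inv descents_def)
  have less: "f p < f q" if "p < q" "q \<le> a1 \<or> a3 < p" for p q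
    using less_outside_descents[OF f that a(6)] .
  have inv_less: "p < q" if "f p < f q" "f q \<le> e1 \<or> e3 < f p" for p q
    using less_outside_descents[OF permutes_inv[OF f] that e(6)] by (simp add: inv_f)
  \<comment> \<open>First and last runs of \<open>f\<close> (\<open>fr\<close>, \<open>lr\<close>)
    and of its inverse (\<open>fi\<close>, \<open>li\<close>), phrased as comparisons among the
    named points.\<close>
  have fr: "p < q \<and> q \<le> a1 \<longrightarrow> f p < f q"
    and lr: "p < q \<and> b3 \<le> p \<longrightarrow> f p < f q"
    and fi: "f p < f q \<and> f q \<le> f s1 \<longrightarrow> p < q"
    and li: "f p < f q \<and> f c3 \<le> f p \<longrightarrow> p < q" for p q
    using less[of p q] inv_less[of p q] by (auto simp: b s c f_inv)
  have xy': "f s1 < f y" and uw': "w < b3" "f u < f c3"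
    using xy(4) uw(3,4) by (simp_all add: s c b f_inv)
  show False
    \<comment> \<open>The relative orders of these sixteen points are already contradictory; the instances form a
      minimal inconsistent set.\<close>
    using b a(4,5) des ides xy(1-3) xy' uw(1,2) uw'
      dec[of a1 x y s1] dec[of c3 s3 c1 s1] dec[of a1 x a3 b3] dec[of c3 u w b3]
      dec[of c3 s3 a3 b3] dec[of a1 c2 s2 s1] dec[of a1 b1 c1 s1] dec[of a1 b1 a3 b3]
      dec[of c3 s3 b2 b3] dec[of a1 a2 b2 b3] dec[of a1 s3 y s1] dec[of c3 u c1 s1]
      dec[of a1 b1 w b3] dec[of a1 a2 c1 s1] dec[of a1 c2 a3 b3] dec[of a1 b1 s2 s1]
      two[of c2 b1 x s3] two[of a1 b1 c3 s3] two[of c1 b2 a3 y] two[of c2 b1 x y]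
      two[of c1 w a3 s2] two[of c1 s1 a3 b3] two[of u b1 a2 s3] two[of c1 b2 a3 s2]
      two[of c1 w a3 y]
      inj[of b1 s2] inj[of c1 s2] inj[of c1 u] inj[of s3 u] inj[of a1 c3] inj[of b1 x]
      inj[of c1 y] inj[of b2 a3] inj[of b1 w] inj[of b1 c3] inj[of c2 s3] inj[of a1 s3]
      inj[of a3 x] inj[of a3 w] inj[of b2 s3] inj[of b3 s1] inj[of b3 c1] inj[of a3 s1]
      inj[of b1 a2] inj[of a2 c1] inj[of a3 c2]
      fr[of u w] fr[of c3 a1] fr[of c2 s2] fr[of c3 s3] lr[of b3 s1] lr[of x y] lr[of c2 s2]
      fi[of b3 s1] fi[of b2 a2] fi[of w u] li[of c3 a1] li[of b2 a2]
    using [[smt_timeout = 100, smt_nat_as_int]] by (smt (verit))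
qed

text \<open>The extreme descents supply the cuts, so that only the north-east and south-west
  quadrants can fail to be increasing.\<close>

lemma gridded_A_or_B_if_many_descents:
  assumes f: "f permutes {1..n}" and av: "avoids f"
    and card: "2 < card (descents f)" "2 < card (descents (inv f))"
  shows "gridded A_cells n f \<or> gridded B_cells n f"
proof (rule ccontr)
  assume not_AB: "\<not> (gridded A_cells n f \<or> gridded B_cells n f)"
  note inv = permutes_inv[OF f]
  have "finite (descents f)" "finite (descents (inv f))"
    using descents_subset[OF f] descents_subset[OF inv] finite_subset by blast+
  then obtain a1 a2 a3 e1 e2 e3 where
    a: "a1 \<in> descents f" "a2 \<in> descents f" "a3 \<in> descents f" "a1 < a2" "a2 < a3"
      "\<And>d. d \<in> descents f \<Longrightarrow> a1 \<le> d \<and> d \<le> a3" and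
    e: "e1 \<in> descents (inv f)" "e2 \<in> descents (inv f)" "e3 \<in> descents (inv f)" "e1 < e2" "e2 < e3"
      "\<And>d. d \<in> descents (inv f) \<Longrightarrow> e1 \<le> d \<and> d \<le> e3"
    using three_elements[OF _ card(1)] three_elements[OF _ card(2)] by metis
  have inj: "f p \<noteq> f q" if "p < q" for p q
    using permutes_inj[OF f] that by (metis injD less_irrefl)
  have "f p < f q" if "p < q" "q \<le> a1" for p q
    using less_outside_descents[OF f _ _ a(6)] that by blast
  moreover have "inv f v < inv f w" if "v < w" "w \<le> e1" for v w
    using less_outside_descents[OF inv _ _ e(6)] that by blast
  \<comment> \<open>The run conditions of \<open>gridded_A\<close> hold at these cuts, so its
    condition \<open>ne\<close> must fail.\<close>
  ultimately obtain x y where "a1 < x" "x < y" "e1 < f x" "e1 < f y" "\<not> f x < f y"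
    using gridded_A[OF f, of a1 e1] not_AB by blast
  moreover from this have "f y < f x" using inj[of x y] by linarith
  moreover have "f p < f q" if "p < q" "a3 < p" for p q
    using less_outside_descents[OF f _ _ a(6)] that by blast
  moreover have "inv f v < inv f w" if "v < w" "e3 < v" for v w
    using less_outside_descents[OF inv _ _ e(6)] that by blast
  \<comment> \<open>Likewise \<open>sw\<close> must fail in \<open>gridded_B\<close>.\<close>
  ultimately obtain u w where "w \<le> a3" "u < w" "f u \<le> e3" "f w \<le> e3" "\<not> f u < f w"
    using gridded_B[OF f, of a3 e3] not_AB by blast
  moreover from this have "f w < f u" using inj[of u w] by linarith
  ultimately show False
    using no_inversions_if_many_descents[OF f av a e] \<open>a1 < x\<close> \<open>x < y\<close> \<open>e1 < f y\<close> \<open>f y < f x\<close>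
    by blast
qed

section \<open>Gridded permutations avoid both patterns\<close>

text \<open>Pairs of cells that can contain the first and second point of an inversion.\<close>

definition inverted :: "(nat \<times> nat) set \<Rightarrow> ((nat \<times> nat) \<times> (nat \<times> nat)) set" where
  "inverted S = (\<Union>s \<in> S. \<Union>t \<in> S.
     if s \<noteq> t \<and> fst s \<le> fst t \<and> snd t \<le> snd s then {(s, t)} else {})"

text \<open>4321 is a chain of three inversions, and 2143 is an inversion with another above and to
  its right. The comparisons in \<open>no_2143\<close> are weak because points of different
  inversions may share a column or a row.\<close>

lemma avoids_if_gridded:
  assumes f: "f permutes {1..n}" and g: "gridded S n f"
    and no_4321: "\<forall>(s, t) \<in> inverted S. \<forall>(t', u) \<in> inverted S. t = t' \<longrightarrow> u \<notin> Domain (inverted S)"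
    and no_2143: "\<forall>(s, t) \<in> inverted S. \<forall>(s', t') \<in> inverted S. \<not> (fst t \<le> fst s' \<and> snd s \<le> snd t')"
  shows "avoids f"
proof -
  obtain col row where mono: "mono_on {1..n} col" "mono_on {1..n} row"
    and S: "\<And>p. p \<in> {1..n} \<Longrightarrow> (col p, row (f p)) \<in> S"
    and inc: "\<And>p q. p \<in> {1..n} \<Longrightarrow> q \<in> {1..n} \<Longrightarrow> p < q \<Longrightarrow> col p = col q \<Longrightarrow>
      row (f p) = row (f q) \<Longrightarrow> f p < f q"
    using g unfolding gridded_def by blast
  define cell where "cell p = (col p, row (f p))" for p
  have rng: "f p \<in> {1..n}" if "p \<in> {1..n}" for p
    using permutes_in_image[OF f] that by blast
  note dom = permutes_inversion_in[OF f]
  have inverted: "(cell p, cell q) \<in> inverted S" if pq: "p < q" "f q < f p" for p q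
  proof -
    note p = dom(1)[OF pq] and q = dom(2)[OF pq]
    have "col p \<le> col q" "row (f q) \<le> row (f p)"
      using mono_onD[OF mono(1) p q] mono_onD[OF mono(2) rng[OF q] rng[OF p]] pq by simp_all
    moreover have "cell p \<noteq> cell q"
      using inc[OF p q] pq by (auto simp: cell_def)
    ultimately show ?thesis
      using S[OF p] S[OF q] by (simp add: inverted_def cell_def)
  qed
  have "\<not> (f l < f k \<and> f k < f j \<and> f j < f i)" if "i < j" "j < k" "k < l" for i j k l
  proof
    assume "f l < f k \<and> f k < f j \<and> f j < f i"
    with that have "(cell i, cell j) \<in> inverted S" "(cell j, cell k) \<in> inverted S"
      "(cell k, cell l) \<in> inverted S"
      by (simp_all add: inverted)
    with no_4321 show False by blast
  qed
  moreover have "\<not> (f j < f i \<and> f i < f l \<and> f l < f k)" if "i < j" "j < k" "k < l" for i j k l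
  proof
    assume *: "f j < f i \<and> f i < f l \<and> f l < f k"
    then have ij: "f j < f i" and kl: "f l < f k" by simp_all
    note dom = dom[OF that(1) ij] dom[OF that(3) kl]
    have "col j \<le> col k" "row (f i) \<le> row (f l)"
      using mono_onD[OF mono(1) dom(2,3)] mono_onD[OF mono(2) rng[OF dom(1)] rng[OF dom(4)]] that *
      by simp_all
    then show False
      using no_2143 inverted[OF that(1) ij] inverted[OF that(3) kl] unfolding cell_def by fastforce
  qed
  ultimately show ?thesis unfolding avoids_def by blast
qed

text \<open>With the pairs listed explicitly, both side conditions of
  \<open>avoids_if_gridded\<close> become finite checks.\<close>

lemma inverted_A: "inverted A_cells = {((3,3),(3,2)), ((2,3),(3,3)), ((2,3),(3,2))}"
  by (simp add: inverted_def A_cells_def)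

lemma inverted_B: "inverted B_cells = {((1,2),(2,1)), ((1,2),(1,1)), ((1,1),(2,1))}"
  by (simp add: inverted_def B_cells_def)

text \<open>Each pair leads from one of the three column blocks 1 to 3, 4 to 5, 6 to 8 to a later
  one, so chains have at most two steps.\<close>

lemma inverted_C: "inverted C_cells =
    {((5,3),(7,2)), ((5,3),(6,1)),
     ((4,2),(7,2)), ((4,2),(6,1)),
     ((3,4),(8,4)), ((3,4),(7,2)), ((3,4),(6,1)), ((3,4),(5,3)), ((3,4),(4,2)),
     ((2,3),(7,2)), ((2,3),(6,1)), ((2,3),(5,3)), ((2,3),(4,2)),
     ((1,1),(6,1))}"
  by (simp add: inverted_def C_cells_def)

lemma avoids_if_gridded_A: "f permutes {1..n} \<Longrightarrow> gridded A_cells n f \<Longrightarrow> avoids f"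
  by (erule (1) avoids_if_gridded; unfold inverted_A; simp)

lemma avoids_if_gridded_B: "f permutes {1..n} \<Longrightarrow> gridded B_cells n f \<Longrightarrow> avoids f"
  by (erule (1) avoids_if_gridded; unfold inverted_B; simp)

lemma avoids_if_gridded_C: "f permutes {1..n} \<Longrightarrow> gridded C_cells n f \<Longrightarrow> avoids f"
  by (erule (1) avoids_if_gridded; unfold inverted_C; simp)

section \<open>Assembling the four classes\<close>

lemma avoids_iff_gridded:
  assumes f: "f permutes {1..n}"
  shows "avoids f \<longleftrightarrow> gridded A_cells n f \<or> gridded B_cells n f \<or> gridded C_cells n f \<or>
    gridded (C_cells\<inverse>) n f"
proof
  note inv = permutes_inv[OF f]
  assume av: "avoids f"
  consider "card (descents f) \<le> 2" | "card (descents (inv f)) \<le> 2"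
    | "2 < card (descents f)" "2 < card (descents (inv f))" by linarith
  then show "gridded A_cells n f \<or> gridded B_cells n f \<or> gridded C_cells n f \<or>
    gridded (C_cells\<inverse>) n f"
  proof cases
    case 1
    then show ?thesis using gridded_C_if_few_descents[OF f av] by blast
  next
    case 2
    then show ?thesis
      using gridded_inv[OF f] gridded_C_if_few_descents[OF inv avoids_inv[OF f av]] by blast
  next
    case 3
    then show ?thesis using gridded_A_or_B_if_many_descents[OF f av] by blast
  qed
next
  note inv = permutes_inv[OF f]
  have "avoids f" if "gridded (C_cells\<inverse>) n f"
  proof -
    \<comment> \<open>Transposing gives a gridding of \<open>inv f\<close> by class C; avoidance
      then returns to \<open>f\<close> by inverting twice.\<close>
    have "gridded C_cells n (inv f)"
      using gridded_inv[OF inv, of "C_cells\<inverse>"] that permutes_inv_inv[OF f] by simp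
    then have "avoids (inv (inv f))"
      by (rule avoids_inv[OF inv avoids_if_gridded_C[OF inv]])
    then show ?thesis by (simp add: permutes_inv_inv[OF f])
  qed
  moreover assume "gridded A_cells n f \<or> gridded B_cells n f \<or> gridded C_cells n f \<or>
    gridded (C_cells\<inverse>) n f"
  ultimately show "avoids f"
    using avoids_if_gridded_A[OF f] avoids_if_gridded_B[OF f] avoids_if_gridded_C[OF f] by blast
qed

theorem theorem3p1:
  shows "Av {[4,3,2,1], [2,1,4,3]} = class_A \<union> class_B \<union> class_C \<union> class_D"
proof -
  have A: "class_A = grid_class 3 3 (increasing_cells A_cells)"
    and B: "class_B = grid_class 3 3 (increasing_cells B_cells)"
    and C: "class_C = grid_class 8 4 (increasing_cells C_cells)"
    by (simp_all add: class_A_def class_B_def class_C_def A_cells_def B_cells_def C_cells_def)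
  \<comment> \<open>The diagram of class D is that of class C reflected in the diagonal.\<close>
  have "{(1,1), (3,2), (4,3), (2,4), (3,5), (1,6), (2,7), (4,8)} = C_cells\<inverse>"
    unfolding C_cells_def by auto
  then have D: "class_D = grid_class 4 8 (increasing_cells (C_cells\<inverse>))"
    by (simp add: class_D_def)
  have "A_cells \<subseteq> {1..3} \<times> {1..3}" "B_cells \<subseteq> {1..3} \<times> {1..3}"
    "C_cells \<subseteq> {1..8} \<times> {1..4}" "C_cells\<inverse> \<subseteq> {1..4} \<times> {1..8}"
    by (auto simp: A_cells_def B_cells_def C_cells_def)
  note iffs = this[THEN grid_class_iff]
  show ?thesis
    unfolding A B C D using avoids_iff_gridded[OF perm_fun_permutes]
    by (auto simp only: set_eq_iff Un_iff Av_iff iffs)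
qed

end
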